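(* Let $X$ be a nonempty set, $Y$ a nonempty subset of $X$, and $f,g\in\overline{\Omega}(X,Y)$. Then $(f,g)\in\mathcal{R}$ in $\overline{\Omega}(X,Y)$ if and only if $\pi(f)=\pi(g)$ and $\pi_f(Y)=\pi_g(Y)$.
   Context: $T(X)$ is the semigroup of all maps $X\to X$ under composition; maps are written on the right and composed from left to right, so $x(fg)=(xf)g$, and for $B\subseteq X$, $Bf=\{xf\colon x\in B\}$. Let $\overline{\Omega}(X,Y)=\{f\in T(X)\colon Yf=Y\}$, a subsemigroup of $T(X)$ containing the identity map. For $f\in T(X)$ and $x\in X$, $xf^{-1}=\{z\in X\colon zf=x\}$. For $A\subseteq X$ with $Xf\cap A\neq\emptyset$, let $\pi_f(A)=\{xf^{-1}\colon x\in Xf\cap A\}$, and let $\pi(f)=\pi_f(X)$, which is a partition of $X$. For subcollections $\mathcal{A}$, $\mathcal{B}$ of blocks of two partitions of $X$, $\mathcal{A}\preceq\mathcal{B}$ means that for every $A\in\mathcal{A}$ there is $B\in\mathcal{B}$ with $A\subseteq B$; $\mathcal{A}=\mathcal{B}$ means $\mathcal{A}\preceq\mathcal{B}$ and $\mathcal{B}\preceq\mathcal{A}$. $\mathcal{R}$ is Green's relation: for a semigroup $S$ with identity, $(a,b)\in\mathcal{R}$ iff $a=bc$ and $b=ad$ for some $c,d\in S$. *)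

theory Defs
  imports "HOL-Algebra.Group" "HOL-Library.FuncSet"
begin

text \<open>
  Maps \<open>X \<rightarrow> X\<close> are represented by the extensional functions in \<open>X \<rightarrow>\<^sub>E X\<close>, so that equality of
  maps on \<open>X\<close> is equality of HOL functions.  Maps act on the right and are composed from left to
  right: the product of \<open>f\<close> and \<open>g\<close> sends \<open>x\<close> to \<open>g (f x)\<close>.
\<close>

definition full_transf :: "'a set \<Rightarrow> ('a \<Rightarrow> 'a) monoid" where
  "full_transf X =
    \<lparr>carrier = X \<rightarrow>\<^sub>E X, mult = (\<lambda>f g. compose X g f), one = (\<lambda>x\<in>X. x)\<rparr>"

definition Omega_bar :: "'a set \<Rightarrow> 'a set \<Rightarrow> ('a \<Rightarrow> 'a) monoid" where
  "Omega_bar X Y = (full_transf X)\<lparr>carrier := {f \<in> carrier (full_transf X). f ` Y = Y}\<rparr>"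

definition green_R :: "('a, 'b) monoid_scheme \<Rightarrow> ('a \<times> 'a) set" where
  "green_R S = {(a, b). a \<in> carrier S \<and> b \<in> carrier S \<and>
    (\<exists>c\<in>carrier S. \<exists>d\<in>carrier S. a = b \<otimes>\<^bsub>S\<^esub> c \<and> b = a \<otimes>\<^bsub>S\<^esub> d)}"

definition fibre :: "'a set \<Rightarrow> ('a \<Rightarrow> 'a) \<Rightarrow> 'a \<Rightarrow> 'a set" where
  "fibre X f x = {z \<in> X. f z = x}"

definition ker_blocks_on :: "'a set \<Rightarrow> ('a \<Rightarrow> 'a) \<Rightarrow> 'a set \<Rightarrow> 'a set set" where
  "ker_blocks_on X f A = {fibre X f x | x. x \<in> f ` X \<inter> A}"

definition ker_blocks :: "'a set \<Rightarrow> ('a \<Rightarrow> 'a) \<Rightarrow> 'a set set" where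
  "ker_blocks X f = ker_blocks_on X f X"

text \<open>
  The constant \<open>refines\<close> of \<open>HOL-Library.Disjoint_Sets\<close> does not apply below: it relates two
  partitions of the same set, whereas \<open>ker_blocks_on X f A\<close> need not cover \<open>X\<close>.
\<close>

definition block_le :: "'a set set \<Rightarrow> 'a set set \<Rightarrow> bool" where
  "block_le \<A> \<B> \<longleftrightarrow> (\<forall>A\<in>\<A>. \<exists>B\<in>\<B>. A \<subseteq> B)"

definition block_eq :: "'a set set \<Rightarrow> 'a set set \<Rightarrow> bool" where
  "block_eq \<A> \<B> \<longleftrightarrow> block_le \<A> \<B> \<and> block_le \<B> \<A>"

lemma monoid_full_transf: "monoid (full_transf X)"
  unfolding full_transf_def
  by (rule monoidI) (auto simp: compose_def PiE_iff extensional_def fun_eq_iff)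

lemma monoid_Omega_bar:
  assumes "Y \<subseteq> X"
  shows "monoid (Omega_bar X Y)"
proof -
  have "compose X g f ` Y = Y" if "f ` Y = Y" "g ` Y = Y" for f g
  proof -
    have "compose X g f ` Y = g ` f ` Y"
      unfolding image_image using assms by (intro image_cong) (auto simp: compose_def)
    then show ?thesis using that by simp
  qed
  moreover have "(\<lambda>x\<in>X. x) ` Y = Y"
    using assms by force
  ultimately show ?thesis
    unfolding Omega_bar_def full_transf_def
    by (intro monoidI) (auto simp: compose_def PiE_iff extensional_def fun_eq_iff)
qed

end

theory Submission
  imports Defs
begin

text \<open>
  The relation \<open>\<R>\<close> is divisibility in both directions, so everything rests on deciding when
  \<open>f = g c\<close> is solvable with \<open>c\<close> stabilising \<open>Y\<close>.  Such a \<open>c\<close> must send \<open>g z\<close> to \<open>f z\<close> for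
  all \<open>z \<in> X\<close>, and this prescription is consistent exactly when points identified by \<open>g\<close> are
  identified by \<open>f\<close>, that is, when \<open>\<pi>(g) \<preceq> \<pi>(f)\<close>.  The values of \<open>c\<close> outside \<open>g ` X\<close> do not
  matter: \<open>Y = g ` Y\<close> lies inside \<open>g ` X\<close>, so that \<open>c ` Y = c ` g ` Y = f ` Y = Y\<close> for every
  such \<open>c\<close> (\<open>right_divides_iff\<close>).

  The blocks over \<open>Y\<close> follow the same order.  Since \<open>g ` Y = Y\<close>, each of them contains a point
  of \<open>Y\<close>, and the block of \<open>\<pi>(f)\<close> that contains it has the same point, whose image under \<open>f\<close>
  is again in \<open>Y\<close> (\<open>block_le_on_fixed_set\<close>).
\<close>

lemma carrier_Omega_bar_iff:
  "f \<in> carrier (Omega_bar X Y) \<longleftrightarrow> f \<in> X \<rightarrow>\<^sub>E X \<and> f ` Y = Y"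
  by (simp add: Omega_bar_def full_transf_def)

lemma mult_Omega_bar: "f \<otimes>\<^bsub>Omega_bar X Y\<^esub> g = compose X g f"
  by (simp add: Omega_bar_def full_transf_def)

lemma block_le_ker_blocks_iff:
  assumes "f \<in> X \<rightarrow> X" and "g \<in> X \<rightarrow> X"
  shows "block_le (ker_blocks X g) (ker_blocks X f) \<longleftrightarrow>
    (\<forall>z\<in>X. \<forall>w\<in>X. g z = g w \<longrightarrow> f z = f w)"
proof
  assume le: "block_le (ker_blocks X g) (ker_blocks X f)"
  show "\<forall>z\<in>X. \<forall>w\<in>X. g z = g w \<longrightarrow> f z = f w"
  proof (intro ballI impI)
    fix z w assume zw: "z \<in> X" "w \<in> X" "g z = g w"
    have "fibre X g (g z) \<in> ker_blocks X g"
      using zw assms(2) by (auto simp: ker_blocks_def ker_blocks_on_def)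
    then obtain B where "B \<in> ker_blocks X f" "fibre X g (g z) \<subseteq> B"
      using le unfolding block_le_def by blast
    then obtain x where "fibre X g (g z) \<subseteq> fibre X f x"
      unfolding ker_blocks_def ker_blocks_on_def by blast
    then show "f z = f w"
      using zw by (auto simp: fibre_def)
  qed
next
  assume ker: "\<forall>z\<in>X. \<forall>w\<in>X. g z = g w \<longrightarrow> f z = f w"
  show "block_le (ker_blocks X g) (ker_blocks X f)"
    unfolding block_le_def
  proof
    fix A assume "A \<in> ker_blocks X g"
    then obtain z where z: "z \<in> X" "A = fibre X g (g z)"
      by (auto simp: ker_blocks_def ker_blocks_on_def)
    have "A \<subseteq> fibre X f (f z)"
      unfolding z(2) fibre_def using z(1) ker by blast
    moreover have "fibre X f (f z) \<in> ker_blocks X f"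
      using z assms(1) by (auto simp: ker_blocks_def ker_blocks_on_def)
    ultimately show "\<exists>B\<in>ker_blocks X f. A \<subseteq> B" by blast
  qed
qed

text \<open>
  A block of \<open>g\<close> over a point of \<open>Y\<close> can be written as the block of some \<open>y \<in> Y\<close>, because \<open>g\<close>
  maps \<open>Y\<close> onto \<open>Y\<close>; the block of \<open>f\<close> through the same \<open>y\<close> is then a block over \<open>f y \<in> Y\<close>.
\<close>

lemma block_le_on_fixed_set:
  assumes "Y \<subseteq> X" and "f \<in> X \<rightarrow> X" and "g \<in> X \<rightarrow> X" and "f ` Y \<subseteq> Y" and "Y \<subseteq> g ` Y"
    and le: "block_le (ker_blocks X g) (ker_blocks X f)"
  shows "block_le (ker_blocks_on X g Y) (ker_blocks_on X f Y)"
  unfolding block_le_def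
proof
  fix A assume "A \<in> ker_blocks_on X g Y"
  then obtain y where y: "y \<in> Y" "A = fibre X g (g y)"
    using assms(5) by (auto simp: ker_blocks_on_def)
  have "A \<subseteq> fibre X f (f y)"
    unfolding y(2) fibre_def
    using y(1) le assms(1) unfolding block_le_ker_blocks_iff[OF assms(2,3)] by blast
  moreover have "fibre X f (f y) \<in> ker_blocks_on X f Y"
    using y assms(1,4) by (auto simp: ker_blocks_on_def)
  ultimately show "\<exists>B\<in>ker_blocks_on X f Y. A \<subseteq> B" by blast
qed

text \<open>
  The quotient sends \<open>g z\<close> to \<open>f z\<close>; it stabilises \<open>Y\<close> automatically, since \<open>Y = g ` Y\<close> and
  \<open>f ` Y = Y\<close>.
\<close>

lemma right_divides_iff:
  assumes YX: "Y \<subseteq> X"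
    and f: "f \<in> carrier (Omega_bar X Y)" and g: "g \<in> carrier (Omega_bar X Y)"
  shows "(\<exists>c\<in>carrier (Omega_bar X Y). f = g \<otimes>\<^bsub>Omega_bar X Y\<^esub> c) \<longleftrightarrow>
    block_le (ker_blocks X g) (ker_blocks X f)"
proof -
  have fX: "f \<in> X \<rightarrow>\<^sub>E X" and gX: "g \<in> X \<rightarrow>\<^sub>E X" and fY: "f ` Y = Y" and gY: "g ` Y = Y"
    using f g by (auto simp: carrier_Omega_bar_iff)
  have le_iff: "block_le (ker_blocks X g) (ker_blocks X f) \<longleftrightarrow>
      (\<forall>z\<in>X. \<forall>w\<in>X. g z = g w \<longrightarrow> f z = f w)"
    using fX gX by (intro block_le_ker_blocks_iff) auto
  show ?thesis
    unfolding le_iff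
  proof
    assume "\<exists>c\<in>carrier (Omega_bar X Y). f = g \<otimes>\<^bsub>Omega_bar X Y\<^esub> c"
    then obtain c where "f = compose X c g"
      unfolding mult_Omega_bar by blast
    then have "f z = c (g z)" if "z \<in> X" for z
      using that by (simp add: compose_eq)
    then show "\<forall>z\<in>X. \<forall>w\<in>X. g z = g w \<longrightarrow> f z = f w"
      by metis
  next
    assume ker: "\<forall>z\<in>X. \<forall>w\<in>X. g z = g w \<longrightarrow> f z = f w"
    \<comment> \<open>Outside \<open>g ` X\<close> any value in \<open>X\<close> would do; the identity is the simplest choice.\<close>
    define c where "c = (\<lambda>x\<in>X. if x \<in> g ` X then f (inv_into X g x) else x)"
    have c_g: "c (g z) = f z" if "z \<in> X" for z
    proof -
      have "inv_into X g (g z) \<in> X" "g (inv_into X g (g z)) = g z"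
        using that by (auto intro: inv_into_into f_inv_into_f)
      then have "f (inv_into X g (g z)) = f z"
        using ker that by blast
      moreover have "g z \<in> X"
        using that gX by auto
      ultimately show ?thesis
        using that by (simp add: c_def)
    qed
    have "c \<in> X \<rightarrow>\<^sub>E X"
      unfolding c_def using PiE_mem[OF fX] inv_into_into[of _ g X] by simp
    moreover have "c ` Y = Y"
    proof -
      have "c ` g ` Y = f ` Y"
        unfolding image_image using YX c_g by (intro image_cong) auto
      then show ?thesis by (simp add: fY gY)
    qed
    ultimately have "c \<in> carrier (Omega_bar X Y)"
      by (simp add: carrier_Omega_bar_iff)
    moreover have "f = g \<otimes>\<^bsub>Omega_bar X Y\<^esub> c"
      unfolding mult_Omega_bar
      by (rule extensionalityI[where A = X]) (use fX c_g in \<open>auto simp: compose_def PiE_iff\<close>)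
    ultimately show "\<exists>c\<in>carrier (Omega_bar X Y). f = g \<otimes>\<^bsub>Omega_bar X Y\<^esub> c" by blast
  qed
qed

theorem theorem4p5:
  fixes X Y :: "'a set" and f g :: "'a \<Rightarrow> 'a"
  assumes "X \<noteq> {}" and "Y \<noteq> {}" and "Y \<subseteq> X"
    and "f \<in> carrier (Omega_bar X Y)" and "g \<in> carrier (Omega_bar X Y)"
  shows "(f, g) \<in> green_R (Omega_bar X Y) \<longleftrightarrow>
    block_eq (ker_blocks X f) (ker_blocks X g) \<and>
    block_eq (ker_blocks_on X f Y) (ker_blocks_on X g Y)"
proof -
  have "(f, g) \<in> green_R (Omega_bar X Y) \<longleftrightarrow>
      (\<exists>c\<in>carrier (Omega_bar X Y). f = g \<otimes>\<^bsub>Omega_bar X Y\<^esub> c) \<and>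
      (\<exists>d\<in>carrier (Omega_bar X Y). g = f \<otimes>\<^bsub>Omega_bar X Y\<^esub> d)"
    using assms(4,5) unfolding green_R_def by blast
  also have "\<dots> \<longleftrightarrow> block_eq (ker_blocks X f) (ker_blocks X g)"
    unfolding right_divides_iff[OF assms(3,4,5)] right_divides_iff[OF assms(3,5,4)] block_eq_def
    by blast
  finally have R_iff:
    "(f, g) \<in> green_R (Omega_bar X Y) \<longleftrightarrow> block_eq (ker_blocks X f) (ker_blocks X g)" .
  have maps: "f \<in> X \<rightarrow> X" "g \<in> X \<rightarrow> X" and images: "f ` Y = Y" "g ` Y = Y"
    using assms(4,5) by (auto simp: carrier_Omega_bar_iff)
  have "block_eq (ker_blocks_on X f Y) (ker_blocks_on X g Y)"
    if "block_eq (ker_blocks X f) (ker_blocks X g)"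
    using that block_le_on_fixed_set[OF assms(3) maps]
      block_le_on_fixed_set[OF assms(3) maps(2,1)]
    by (simp add: block_eq_def images)
  then show ?thesis
    using R_iff by blast
qed

end
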